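(* Let $A$ be a unital complex Banach algebra, let $\lambda_1,\dots,\lambda_n\in\mathbb{C}$ be pairwise distinct, let $p(\lambda):=\prod_{i=1}^n(\lambda-\lambda_i)$, and let $E_p(A):=\{a\in A\mid p(a)=0\}$. Let $C$ be a connected component of $E_p(A)$. If $C$ is disjoint from the centre of $A$, then any element of $C$ belongs to a complex line entirely contained in $C$. In particular, $C$ is unbounded.
   Context: $E_p(A)$ carries the subspace topology from the norm topology of $A$, and connected components are taken in this topology. For $a\in A$, $p(a):=\prod_{i=1}^n(a-\lambda_i 1)$. The centre of $A$ is $\{z\in A\mid za=az \text{ for all } a\in A\}$. A complex line in $A$ is a set of the form $\{a_0+\lambda b\mid\lambda\in\mathbb{C}\}$ with $a_0,b\in A$ and $b\neq 0$. Unbounded means unbounded in the norm of $A$. *)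

theory Defs
  imports "HOL-Analysis.Analysis"
begin

text \<open>
  Unital complex Banach algebras. The real scalar multiplication of the library classes is
  the restriction of \<^term>\<open>scaleC\<close> to the reals. The norm is submultiplicative and complete;
  \<open>norm 1 = 1\<close> is not required, so both usual conventions on the norm of the unit are covered.
  The library's \<^class>\<open>ring_1\<close> excludes the zero algebra.
\<close>

class complex_banach_algebra_1 = real_algebra_1 + real_normed_algebra + banach +
  fixes scaleC :: "complex \<Rightarrow> 'a \<Rightarrow> 'a"  (infixr "*\<^sub>C" 75)
  assumes scaleC_add_right: "c *\<^sub>C (x + y) = c *\<^sub>C x + c *\<^sub>C y"
    and scaleC_add_left: "(c + d) *\<^sub>C x = c *\<^sub>C x + d *\<^sub>C x"
    and scaleC_scaleC: "c *\<^sub>C d *\<^sub>C x = (c * d) *\<^sub>C x"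
    and scaleC_one: "1 *\<^sub>C x = x"
    and scaleR_scaleC: "r *\<^sub>R x = complex_of_real r *\<^sub>C x"
    and mult_scaleC_left: "(c *\<^sub>C x) * y = c *\<^sub>C (x * y)"
    and mult_scaleC_right: "x * (c *\<^sub>C y) = c *\<^sub>C (x * y)"
    and norm_scaleC: "norm (c *\<^sub>C x) = cmod c * norm x"

instantiation complex :: complex_banach_algebra_1
begin

definition scaleC_complex :: "complex \<Rightarrow> complex \<Rightarrow> complex"
  where "scaleC_complex c x = c * x"

instance
  by standard (simp_all add: scaleC_complex_def algebra_simps norm_mult scaleR_conv_of_real)

end

text \<open>
  The product is taken in the order \<open>i = 1, \<dots>, n\<close>; \<^const>\<open>prod\<close> is unavailable because the
  algebra need not be commutative.
\<close>

definition poly_with_roots :: "nat \<Rightarrow> (nat \<Rightarrow> complex) \<Rightarrow> 'a \<Rightarrow> 'a::complex_banach_algebra_1"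
  where "poly_with_roots n lam a = prod_list (map (\<lambda>i. a - lam i *\<^sub>C 1) [1..<Suc n])"

definition E_p :: "nat \<Rightarrow> (nat \<Rightarrow> complex) \<Rightarrow> 'a::complex_banach_algebra_1 set"
  where "E_p n lam = {a. poly_with_roots n lam a = 0}"

definition centre :: "'a::complex_banach_algebra_1 set"
  where "centre = {z. \<forall>a. z * a = a * z}"

definition complex_line :: "'a::complex_banach_algebra_1 set \<Rightarrow> bool"
  where "complex_line L \<longleftrightarrow> (\<exists>a\<^sub>0 b. b \<noteq> 0 \<and> L = {a\<^sub>0 + c *\<^sub>C b | c. True})"

end

theory Submission imports Defs begin

text \<open>
  The idea is that a non-central \<open>a \<in> E\<^sub>p(A)\<close> can be conjugated along a complex line.
  Suppose that some \<open>y \<noteq> 0\<close> satisfies \<open>a y = \<mu> y\<close> and \<open>y a = \<nu> y\<close> with \<open>\<mu> \<noteq> \<nu>\<close>. Evaluating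
  \<open>y a y\<close> in two ways gives \<open>y\<^sup>2 = 0\<close>, so \<open>1 + t y\<close> is invertible with inverse \<open>1 - t y\<close>, and
  \<open>(1 + t y) a (1 - t y) = a + t (\<nu> - \<mu>) y\<close>. Since \<open>E\<^sub>p(A)\<close> is invariant under conjugation, the
  complex line through \<open>a\<close> in direction \<open>y\<close> lies in \<open>E\<^sub>p(A)\<close>. A line is connected, so it lies in
  the component of \<open>a\<close>; and it is unbounded.

  Such a \<open>y\<close> is found as a joint eigenvector of left and right multiplication by \<open>a\<close>
  (lemma \<open>joint_eigenvector_if_not_commute\<close>). If \<open>a x \<noteq> x a\<close>, start from the commutator
  \<open>a x - x a\<close> and multiply it from the left by factors of \<open>p(a)\<close> until one more factor would
  annihilate it, then do the same from the right. The result \<open>y = a x' - x' a\<close> is nonzero, is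
  still a commutator, and has eigenvalues \<open>\<mu>\<close> and \<open>\<nu>\<close> among the roots of \<open>p\<close>. Only here does it
  matter that the roots are simple: with \<open>s\<close> the cofactor \<open>p(\<lambda>) / (\<lambda> - \<mu>)\<close>, the equality
  \<open>\<mu> = \<nu>\<close> would give \<open>s(\<mu>)\<^sup>2 y = s(a) y s(a) = \<mu> s(a) x' s(a) - \<mu> s(a) x' s(a) = 0\<close>, although
  \<open>s(\<mu>) \<noteq> 0\<close>.
\<close>

section \<open>Scalar multiplication\<close>

lemma scaleC_zero_left [simp]: "0 *\<^sub>C x = (0::'a::complex_banach_algebra_1)"
  using scaleC_add_left[of 0 0 x] by simp

lemma scaleC_zero_right [simp]: "c *\<^sub>C 0 = (0::'a::complex_banach_algebra_1)"
  using scaleC_add_right[of c 0 0] by simp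

lemma scaleC_diff_left: "(c - d) *\<^sub>C x = c *\<^sub>C x - d *\<^sub>C (x::'a::complex_banach_algebra_1)"
  using scaleC_add_left[of "c - d" d x] by (simp add: algebra_simps)

lemma scaleC_eq_0_iff: "c *\<^sub>C x = 0 \<longleftrightarrow> c = 0 \<or> x = (0::'a::complex_banach_algebra_1)"
  using norm_scaleC[of c x] by (metis mult_eq_0_iff norm_eq_zero)

section \<open>Products of linear factors\<close>

text \<open>
  Indexing the roots by a list makes it possible to split off the factors of \<open>p(a)\<close> one at a time
  by structural induction.
\<close>

definition root_prod :: "complex list \<Rightarrow> 'a \<Rightarrow> 'a::complex_banach_algebra_1"
  where "root_prod ls a = prod_list (map (\<lambda>l. a - l *\<^sub>C 1) ls)"

lemma root_prod_Nil [simp]: "root_prod [] a = 1"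
  and root_prod_Cons: "root_prod (l # ls) a = (a - l *\<^sub>C 1) * root_prod ls a"
  and root_prod_append: "root_prod (us @ vs) a = root_prod us a * root_prod vs a"
  by (simp_all add: root_prod_def)

lemma poly_with_roots_eq_root_prod:
  "poly_with_roots n lam a = root_prod (map lam [1..<Suc n]) a"
  by (simp add: poly_with_roots_def root_prod_def comp_def del: upt_Suc)

lemma shift_mult: "(a - l *\<^sub>C 1) * x = a * x - l *\<^sub>C (x::'a::complex_banach_algebra_1)"
  and mult_shift: "x * (a - l *\<^sub>C 1) = x * a - l *\<^sub>C x"
  by (simp_all add: algebra_simps mult_scaleC_left mult_scaleC_right)

lemma root_prod_commute: "root_prod ls a * a = a * root_prod ls a"
proof (induction ls)
  case (Cons l ls)
  then show ?case
    by (simp add: root_prod_Cons shift_mult algebra_simps mult_scaleC_left mult_scaleC_right)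
qed simp

lemma root_prod_remove_factor:
  "root_prod (us @ l # vs) a = (a - l *\<^sub>C 1) * root_prod (us @ vs) a"
proof -
  have "root_prod us a * (a - l *\<^sub>C 1) = (a - l *\<^sub>C 1) * root_prod us a"
    by (simp add: shift_mult mult_shift root_prod_commute)
  then show ?thesis
    by (simp add: root_prod_append root_prod_Cons flip: mult.assoc)
qed

lemma root_prod_eigen_left:
  assumes "a * y = m *\<^sub>C y"
  shows "root_prod ls a * y = (\<Prod>l\<leftarrow>ls. m - l) *\<^sub>C y"
proof (induction ls)
  case (Cons l ls)
  have "root_prod (l # ls) a * y = (a - l *\<^sub>C 1) * (root_prod ls a * y)"
    by (simp add: root_prod_Cons mult.assoc)
  also have "\<dots> = (\<Prod>l\<leftarrow>ls. m - l) *\<^sub>C ((a - l *\<^sub>C 1) * y)"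
    by (simp add: Cons mult_scaleC_right)
  also have "\<dots> = (\<Prod>l\<leftarrow>l # ls. m - l) *\<^sub>C y"
    by (simp add: shift_mult assms scaleC_diff_left[symmetric] scaleC_scaleC mult.commute)
  finally show ?case .
qed (simp add: scaleC_one)

lemma root_prod_eigen_right:
  assumes "y * a = m *\<^sub>C y"
  shows "y * root_prod ls a = (\<Prod>l\<leftarrow>ls. m - l) *\<^sub>C y"
proof (induction ls)
  case (Cons l ls)
  have "y * root_prod (l # ls) a = (y * (a - l *\<^sub>C 1)) * root_prod ls a"
    by (simp add: root_prod_Cons mult.assoc)
  also have "\<dots> = (m - l) *\<^sub>C (y * root_prod ls a)"
    by (simp add: mult_shift assms scaleC_diff_left[symmetric] mult_scaleC_left)
  also have "\<dots> = (\<Prod>l\<leftarrow>l # ls. m - l) *\<^sub>C y"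
    by (simp add: Cons scaleC_scaleC)
  finally show ?case .
qed (simp add: scaleC_one)

section \<open>Joint eigenvectors of left and right multiplication\<close>

text \<open>
  The last factor whose multiplication does not yet annihilate \<open>w\<close> leaves an eigenvector; its
  eigenvalue is the next root.
\<close>

lemma eigenvector_left:
  assumes "root_prod ls a * w = 0" and "w \<noteq> 0"
  obtains us l vs where "ls = us @ l # vs" and "root_prod vs a * w \<noteq> 0"
    and "a * (root_prod vs a * w) = l *\<^sub>C (root_prod vs a * w)"
  using assms
proof (induction ls arbitrary: thesis)
  case (Cons k ls)
  show ?case
  proof (cases "root_prod ls a * w = 0")
    case True
    then show ?thesis
      using Cons.IH[OF _ True \<open>w \<noteq> 0\<close>] Cons.prems(1) by (metis append_Cons)
  next
    case False
    have "(a - k *\<^sub>C 1) * (root_prod ls a * w) = 0"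
      using Cons.prems(2) by (simp add: root_prod_Cons mult.assoc)
    then have "a * (root_prod ls a * w) = k *\<^sub>C (root_prod ls a * w)"
      by (simp add: shift_mult)
    then show ?thesis
      using Cons.prems(1)[of "[]"] False by simp
  qed
qed simp

lemma eigenvector_right:
  assumes "w * root_prod ls a = 0" and "w \<noteq> 0"
  obtains us l vs where "ls = us @ l # vs" and "w * root_prod us a \<noteq> 0"
    and "w * root_prod us a * a = l *\<^sub>C (w * root_prod us a)"
  using assms
proof (induction ls arbitrary: thesis rule: rev_induct)
  case (snoc k ls)
  show ?case
  proof (cases "w * root_prod ls a = 0")
    case True
    then show ?thesis
      using snoc.IH[OF _ True \<open>w \<noteq> 0\<close>] snoc.prems(1) by (metis append_Cons append_assoc)
  next
    case False
    have "w * root_prod ls a * (a - k *\<^sub>C 1) = 0"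
      using snoc.prems(2) by (simp add: root_prod_append root_prod_Cons mult.assoc)
    then have "w * root_prod ls a * a = k *\<^sub>C (w * root_prod ls a)"
      by (simp add: mult_shift)
    then show ?thesis
      using snoc.prems(1)[of ls k "[]"] False by simp
  qed
qed simp

text \<open>
  When the roots are distinct, \<open>a\<close> is a combination of orthogonal idempotents, and a commutator
  with \<open>a\<close> vanishes in every diagonal Peirce corner of these. The proof replaces the idempotent
  at \<open>m\<close> by a multiple of it, the cofactor \<open>s\<close> of \<open>a - m\<close>: both \<open>s a x s\<close> and \<open>s x a s\<close> equal
  \<open>m s x s\<close>, while \<open>s y s\<close> is a nonzero multiple of \<open>y\<close>.
\<close>

lemma commutator_joint_eigenvalue_eq_0:
  assumes "root_prod ls a = 0" and "distinct ls" and "m \<in> set ls"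
    and y: "y = a * x - x * a" and left: "a * y = m *\<^sub>C y" and right: "y * a = m *\<^sub>C y"
  shows "y = 0"
proof -
  obtain us vs where ls: "ls = us @ m # vs"
    using \<open>m \<in> set ls\<close> by (meson split_list)
  define s where "s = root_prod (us @ vs) a"
  define d where "d = (\<Prod>l\<leftarrow>us @ vs. m - l)"
  have "d \<noteq> 0"
    using \<open>distinct ls\<close> by (auto simp: d_def ls prod_list_zero_iff)
  have as: "a * s = m *\<^sub>C s"
    using assms(1) by (simp add: ls root_prod_remove_factor s_def shift_mult)
  then have sa: "s * a = m *\<^sub>C s"
    by (simp add: s_def root_prod_commute)
  have "s * y * s = s * a * x * s - s * x * (a * s)"
    by (simp add: y algebra_simps)
  also have "\<dots> = 0"
    by (simp add: as sa mult_scaleC_left mult_scaleC_right)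
  finally have "s * y * s = 0" .
  moreover have "s * y * s = d *\<^sub>C d *\<^sub>C y"
    using root_prod_eigen_left[OF left, of "us @ vs"] root_prod_eigen_right[OF right, of "us @ vs"]
    by (simp add: s_def d_def mult_scaleC_left)
  ultimately show ?thesis
    using \<open>d \<noteq> 0\<close> by (simp add: scaleC_eq_0_iff)
qed

text \<open>
  Multiplying a commutator with \<open>a\<close> on either side by polynomials in \<open>a\<close> gives again a
  commutator with \<open>a\<close>, so the eigenvector reached from \<open>a x - x a\<close> has two distinct eigenvalues.
\<close>

lemma joint_eigenvector_if_not_commute:
  assumes p: "root_prod ls a = 0" and "distinct ls" and "a * x \<noteq> x * a"
  obtains y m k where "y \<noteq> 0" and "m \<noteq> k" and "a * y = m *\<^sub>C y" and "y * a = k *\<^sub>C y"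
proof -
  define z where "z = a * x - x * a"
  have "z \<noteq> 0" and "root_prod ls a * z = 0"
    using assms by (auto simp: z_def)
  then obtain us m vs where ls: "ls = us @ m # vs" and "root_prod vs a * z \<noteq> 0"
    and u: "a * (root_prod vs a * z) = m *\<^sub>C (root_prod vs a * z)"
    by (meson eigenvector_left)
  define q where "q = root_prod vs a"
  have "q * z \<noteq> 0" and "q * z * root_prod ls a = 0"
    using \<open>root_prod vs a * z \<noteq> 0\<close> p by (auto simp: q_def)
  then obtain us' k vs' where "q * z * root_prod us' a \<noteq> 0"
    and yk: "q * z * root_prod us' a * a = k *\<^sub>C (q * z * root_prod us' a)"
    by (meson eigenvector_right)
  define r where "r = root_prod us' a"
  define y where "y = q * z * r"
  have "y \<noteq> 0" and "y * a = k *\<^sub>C y"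
    using \<open>q * z * root_prod us' a \<noteq> 0\<close> yk by (simp_all add: y_def r_def)
  have "a * y = a * (q * z) * r"
    by (simp add: y_def mult.assoc)
  also have "\<dots> = m *\<^sub>C y"
    using u by (simp add: q_def y_def mult_scaleC_left)
  finally have "a * y = m *\<^sub>C y" .
  have "q * a = a * q" and "r * a = a * r"
    by (simp_all add: q_def r_def root_prod_commute)
  have "y = (q * a) * x * r - q * x * (a * r)"
    by (simp add: y_def z_def algebra_simps)
  also have "\<dots> = a * (q * x * r) - (q * x * r) * a"
    by (simp add: \<open>q * a = a * q\<close> \<open>r * a = a * r\<close>[symmetric] mult.assoc)
  finally have y: "y = a * (q * x * r) - (q * x * r) * a" .
  have "m \<noteq> k"
  proof
    assume "m = k"
    then have "y = 0"
      using commutator_joint_eigenvalue_eq_0[OF p \<open>distinct ls\<close> _ y \<open>a * y = m *\<^sub>C y\<close>]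
        \<open>y * a = k *\<^sub>C y\<close> ls by simp
    with \<open>y \<noteq> 0\<close> show False ..
  qed
  then show thesis
    using that \<open>y \<noteq> 0\<close> \<open>a * y = m *\<^sub>C y\<close> \<open>y * a = k *\<^sub>C y\<close> by blast
qed

section \<open>Lines of conjugates\<close>

lemma root_prod_conjugate:
  assumes "u * v = 1" and "v * u = 1"
  shows "root_prod ls (u * a * v) = u * root_prod ls a * v"
proof (induction ls)
  case (Cons l ls)
  have "u * a * v - l *\<^sub>C 1 = u * (a - l *\<^sub>C 1) * v"
    using assms by (simp add: algebra_simps mult_scaleC_left mult_scaleC_right)
  then have "root_prod (l # ls) (u * a * v) = u * (a - l *\<^sub>C 1) * v * (u * root_prod ls a * v)"
    by (simp only: root_prod_Cons Cons.IH)
  also have "\<dots> = u * (a - l *\<^sub>C 1) * (v * u) * root_prod ls a * v"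
    by (simp only: mult.assoc)
  finally show ?case
    by (simp only: assms root_prod_Cons mult.assoc mult_1_left)
qed (simp add: assms)

text \<open>
  The line \<open>a + c y\<close> consists of conjugates of \<open>a\<close> by the unipotent elements \<open>1 + t y\<close>.
\<close>

lemma root_prod_line_eq_0:
  assumes p: "root_prod ls a = 0"
    and "m \<noteq> k" and left: "a * y = m *\<^sub>C y" and right: "y * a = k *\<^sub>C y"
  shows "root_prod ls (a + c *\<^sub>C y) = 0"
proof -
  have "m *\<^sub>C (y * y) = y * a * y"
    by (simp add: mult.assoc left mult_scaleC_right)
  also have "\<dots> = k *\<^sub>C (y * y)"
    by (simp add: right mult_scaleC_left)
  finally have "(m - k) *\<^sub>C (y * y) = 0"
    by (simp add: scaleC_diff_left)
  then have yy: "y * y = 0"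
    using \<open>m \<noteq> k\<close> by (simp add: scaleC_eq_0_iff)
  \<comment> \<open>Conjugation by \<open>1 + t y\<close> moves \<open>a\<close> by \<open>t (k - m) y\<close>, which is to equal \<open>c y\<close>.\<close>
  define t where "t = c / (k - m)"
  define u where "u = 1 + t *\<^sub>C y"
  define v where "v = 1 - t *\<^sub>C y"
  have uv: "u * v = 1" "v * u = 1"
    by (simp_all add: u_def v_def algebra_simps mult_scaleC_left mult_scaleC_right yy)
  have ua: "u * a = a + (t * k) *\<^sub>C y"
    by (simp add: u_def distrib_right mult_scaleC_left right scaleC_scaleC)
  have "u * a * v = a + (t * k) *\<^sub>C y - (t * m) *\<^sub>C y"
    by (simp add: ua v_def algebra_simps mult_scaleC_left mult_scaleC_right left yy scaleC_scaleC)
  also have "\<dots> = a + (t * k - t * m) *\<^sub>C y"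
    by (simp add: scaleC_diff_left)
  also have "t * k - t * m = c"
    using \<open>m \<noteq> k\<close> by (simp add: t_def flip: diff_divide_distrib right_diff_distrib)
  finally have "u * a * v = a + c *\<^sub>C y" .
  then show ?thesis
    using root_prod_conjugate[OF uv, of ls a] p by simp
qed

lemma line_through_noncentral:
  assumes "root_prod ls a = 0" and "distinct ls" and "a \<notin> centre"
  obtains L where "complex_line L" and "a \<in> L" and "\<And>b. b \<in> L \<Longrightarrow> root_prod ls b = 0"
proof -
  obtain x where "a * x \<noteq> x * a"
    using \<open>a \<notin> centre\<close> by (auto simp: centre_def)
  then obtain y m k where y: "y \<noteq> 0" "m \<noteq> k" "a * y = m *\<^sub>C y" "y * a = k *\<^sub>C y"
    using joint_eigenvector_if_not_commute assms(1,2) by blast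
  define L where "L = {a + c *\<^sub>C y | c. True}"
  show thesis
  proof
    show "complex_line L"
      using y(1) unfolding complex_line_def L_def by blast
    show "a \<in> L"
      unfolding L_def by (auto intro!: exI[of _ 0])
    show "root_prod ls b = 0" if "b \<in> L" for b
      using that root_prod_line_eq_0[OF assms(1) y(2-4)] by (auto simp: L_def)
  qed
qed

section \<open>Topology of complex lines\<close>

lemma complex_line_connected:
  assumes "complex_line L"
  shows "connected L"
proof -
  obtain a b where L: "L = {a + c *\<^sub>C b | c. True}"
    using assms by (auto simp: complex_line_def)
  have "convex L"
  proof (rule convexI)
    fix x y and u v :: real
    assume "x \<in> L" "y \<in> L" and uv: "u + v = 1"
    then obtain c d where x: "x = a + c *\<^sub>C b" and y: "y = a + d *\<^sub>C b"
      by (auto simp: L)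
    have "u *\<^sub>R x + v *\<^sub>R y = (u + v) *\<^sub>R a + (u *\<^sub>R c *\<^sub>C b + v *\<^sub>R d *\<^sub>C b)"
      by (simp add: x y algebra_simps)
    also have "\<dots> = a + (of_real u * c + of_real v * d) *\<^sub>C b"
      by (simp add: uv scaleR_scaleC scaleC_scaleC scaleC_add_left scaleC_one)
    finally show "u *\<^sub>R x + v *\<^sub>R y \<in> L"
      unfolding L by blast
  qed
  then show ?thesis
    by (rule convex_connected)
qed

lemma complex_line_unbounded:
  assumes "complex_line L"
  shows "\<not> bounded L"
proof
  obtain a b where L: "L = {a + c *\<^sub>C b | c. True}" and "b \<noteq> 0"
    using assms by (auto simp: complex_line_def)
  assume "bounded L"
  then obtain B where B: "\<And>x. x \<in> L \<Longrightarrow> norm x \<le> B"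
    by (auto simp: bounded_iff)
  define r where "r = (\<bar>B\<bar> + norm a + 1) / norm b"
  have "norm (of_real r *\<^sub>C b) = \<bar>B\<bar> + norm a + 1"
    using \<open>b \<noteq> 0\<close> by (simp add: norm_scaleC r_def del: of_real_divide of_real_add)
  moreover have "norm (a + of_real r *\<^sub>C b) \<le> B"
    by (rule B) (auto simp: L)
  moreover have "norm (of_real r *\<^sub>C b) \<le> norm (a + of_real r *\<^sub>C b) + norm a"
    by (metis add_diff_cancel_left' norm_triangle_ineq4)
  ultimately show False
    by linarith
qed

section \<open>Components without central elements\<close>

theorem theorem7:
  fixes lam :: "nat \<Rightarrow> complex" and n :: nat
    and C :: "'a::complex_banach_algebra_1 set"
  assumes "inj_on lam {1..n}"
    and "C \<in> components (E_p n lam)"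
    and "C \<inter> centre = {}"
  shows "(\<forall>a\<in>C. \<exists>L. complex_line L \<and> a \<in> L \<and> L \<subseteq> C) \<and> \<not> bounded C"
proof -
  define ls where "ls = map lam [1..<Suc n]"
  have "distinct ls"
    using assms(1) by (simp add: ls_def distinct_map atLeastLessThanSuc_atLeastAtMost del: upt_Suc)
  have E: "E_p n lam = {a::'a. root_prod ls a = 0}"
    by (simp add: E_p_def poly_with_roots_eq_root_prod ls_def)
  have lines: "\<exists>L. complex_line L \<and> a \<in> L \<and> L \<subseteq> C" if "a \<in> C" for a
  proof -
    have "root_prod ls a = 0"
      using in_components_subset[OF assms(2)] that by (auto simp: E)
    moreover have "a \<notin> centre"
      using assms(3) that by blast
    ultimately obtain L where L: "complex_line L" "a \<in> L" "\<And>b. b \<in> L \<Longrightarrow> root_prod ls b = 0"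
      using line_through_noncentral \<open>distinct ls\<close> by blast
    have "L \<subseteq> C"
    proof (rule components_maximal[OF assms(2)])
      show "connected L"
        by (rule complex_line_connected) fact
      show "L \<subseteq> E_p n lam"
        using L(3) by (auto simp: E)
      show "C \<inter> L \<noteq> {}"
        using L(2) that by blast
    qed
    with L show ?thesis
      by blast
  qed
  moreover have "\<not> bounded C"
  proof -
    obtain a where "a \<in> C"
      using in_components_nonempty[OF assms(2)] by blast
    then obtain L where "complex_line L" and "L \<subseteq> C"
      using lines by blast
    then show ?thesis
      using complex_line_unbounded bounded_subset by blast
  qed
  ultimately show ?thesis
    by blast
qed

end
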